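(* Let $X,Y$ be normed linear spaces, $\beta,\varepsilon\in[0,1)$, and let $0\neq T\in\mathcal{L}(X,Y)$ be a scalar multiple of an $\varepsilon$-isometry, with $\delta_1,\delta_2$ as in the definition of an $\varepsilon$-isometry. Then: (i) $T$ is $D^\beta D^\eta$-P, where $\eta=\sqrt{1-\left(\frac{1-\delta_1(\varepsilon)}{1+\delta_2(\varepsilon)}\right)^2(1-\beta^2)}$; (ii) $T$ is $B^\beta D^\eta$-P for $\eta=\sqrt{1-\left(\frac{1-\delta_1(\varepsilon)}{1+\delta_2(\varepsilon)}\right)^2\left(\frac{1-\beta}{1+\beta}\right)^2}$; (iii) $T$ is $RD^\eta$-P and $RD^\eta$-R for $\eta=\sqrt{1-\left(\frac{1-\delta_1(\varepsilon)}{1+\delta_2(\varepsilon)}\right)^2}$.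
   Context: All normed spaces are real; $\mathcal{L}(X,Y)$ is the space of bounded linear operators from $X$ to $Y$. For $x,y$ in a normed space and $\varepsilon\in[0,1)$: $x\perp_{D^\varepsilon}y$ means $\|x+\lambda y\|\ge\sqrt{1-\varepsilon^2}\,\|x\|$ for all $\lambda\in\mathbb{R}$; $x\perp_{B^\varepsilon}y$ means $\|x+\lambda y\|^2\ge\|x\|^2-2\varepsilon\|x\|\|\lambda y\|$ for all $\lambda\in\mathbb{R}$; $x\perp_R y$ (Roberts orthogonality) means $\|x+\lambda y\|=\|x-\lambda y\|$ for all $\lambda\in\mathbb{R}$. For $\eta\in[0,1)$ and $\Delta\in\{R,B^\beta,D^\beta\}$, $T$ is $\Delta D^\eta$-P (respectively $\Delta D^\eta$-R) if for all $x,y\in X$, $x\perp_\Delta y$ implies $Tx\perp_{D^\eta}Ty$ (respectively $Ty\perp_{D^\eta}Tx$). A linear map $U:X\to Y$ is said to be an $\varepsilon$-isometry if $(1-\delta_1(\varepsilon))\|x\|\le\|Ux\|\le(1+\delta_2(\varepsilon))\|x\|$ for all $x\in X$, where $\lim_{\varepsilon\to0}\delta_1(\varepsilon)=0$ and $\lim_{\varepsilon\to0}\delta_2(\varepsilon)=0$.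
   Formalization: The formal theorem additionally assumes δ₁(ε) < 1; for δ₁(ε) = 1 the given η equals 1, outside [0,1), and for δ₁(ε) > 1 the lower bound is vacuous and the claim can fail (e.g. δ₁(ε) = 3, δ₂(ε) = 1, a non-injective U of norm at most 2). *)

theory Defs
  imports "HOL-Analysis.Bounded_Linear_Function"
begin

definition orth_D :: "real \<Rightarrow> 'a::real_normed_vector \<Rightarrow> 'a \<Rightarrow> bool" where
  "orth_D \<epsilon> x y \<longleftrightarrow> (\<forall>t::real. norm (x + t *\<^sub>R y) \<ge> sqrt (1 - \<epsilon>\<^sup>2) * norm x)"

definition orth_B :: "real \<Rightarrow> 'a::real_normed_vector \<Rightarrow> 'a \<Rightarrow> bool" where
  "orth_B \<epsilon> x y \<longleftrightarrow>
    (\<forall>t::real. (norm (x + t *\<^sub>R y))\<^sup>2 \<ge> (norm x)\<^sup>2 - 2 * \<epsilon> * norm x * norm (t *\<^sub>R y))"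

definition orth_R :: "'a::real_normed_vector \<Rightarrow> 'a \<Rightarrow> bool" where
  "orth_R x y \<longleftrightarrow> (\<forall>t::real. norm (x + t *\<^sub>R y) = norm (x - t *\<^sub>R y))"

text \<open>
  The properties \<open>\<Delta>D\<^sup>\<eta>-P\<close> and \<open>\<Delta>D\<^sup>\<eta>-R\<close>, for an orthogonality relation \<open>\<Delta>\<close> on the domain.
  They are only meaningful for \<open>\<eta> \<in> [0,1)\<close>, so this range is part of the predicates:
  asserting one of them also asserts that \<open>\<eta>\<close> is admissible.
\<close>

definition preserves_D ::
    "('a::real_normed_vector \<Rightarrow> 'a \<Rightarrow> bool) \<Rightarrow> real \<Rightarrow> ('a \<Rightarrow> 'b::real_normed_vector) \<Rightarrow> bool" where
  "preserves_D \<Delta> \<eta> T \<longleftrightarrow> \<eta> \<in> {0..<1} \<and> (\<forall>x y. \<Delta> x y \<longrightarrow> orth_D \<eta> (T x) (T y))"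

definition reverses_D ::
    "('a::real_normed_vector \<Rightarrow> 'a \<Rightarrow> bool) \<Rightarrow> real \<Rightarrow> ('a \<Rightarrow> 'b::real_normed_vector) \<Rightarrow> bool" where
  "reverses_D \<Delta> \<eta> T \<longleftrightarrow> \<eta> \<in> {0..<1} \<and> (\<forall>x y. \<Delta> x y \<longrightarrow> orth_D \<eta> (T y) (T x))"

text \<open>
  The bounds \<open>\<delta>\<^sub>1, \<delta>\<^sub>2\<close> are functions of \<open>\<epsilon> \<in> [0,1)\<close>, hence the one-sided limits. They are not
  assumed nonnegative.
\<close>

definition eps_isometry ::
    "(real \<Rightarrow> real) \<Rightarrow> (real \<Rightarrow> real) \<Rightarrow> real \<Rightarrow>
     ('a::real_normed_vector \<Rightarrow> 'b::real_normed_vector) \<Rightarrow> bool" where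
  "eps_isometry \<delta>\<^sub>1 \<delta>\<^sub>2 \<epsilon> U \<longleftrightarrow>
     linear U \<and>
     (\<delta>\<^sub>1 \<longlongrightarrow> 0) (at 0 within {0..<1}) \<and> (\<delta>\<^sub>2 \<longlongrightarrow> 0) (at 0 within {0..<1}) \<and>
     (\<forall>x. (1 - \<delta>\<^sub>1 \<epsilon>) * norm x \<le> norm (U x) \<and> norm (U x) \<le> (1 + \<delta>\<^sub>2 \<epsilon>) * norm x)"

end

theory Submission
  imports Defs
begin

text \<open>
  Each of the three orthogonality relations bounds the distance from \<open>x\<close> to the line spanned by
  \<open>y\<close> from below by \<open>k * norm x\<close>, with \<open>k = sqrt (1 - \<beta>\<^sup>2)\<close>, \<open>(1 - \<beta>) / (1 + \<beta>)\<close> and \<open>1\<close>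
  respectively. A multiple of an \<open>\<epsilon>\<close>-isometry distorts ratios of norms by at most the factor
  \<open>q = (1 - \<delta>\<^sub>1 \<epsilon>) / (1 + \<delta>\<^sub>2 \<epsilon>)\<close>, so the same bound holds for the images with \<open>q * k\<close>, and
  \<open>\<eta>\<close> is determined by \<open>sqrt (1 - \<eta>\<^sup>2) = q * k\<close>.
\<close>

text \<open>The quadratic condition only matters to first order at \<open>x\<close>: convexity of
  the norm along the segment from \<open>x\<close> to \<open>x + t *\<^sub>R y\<close> carries that
  slope out to the endpoint.\<close>

lemma orth_B_imp_norm_ge:
  assumes "orth_B \<beta> x y" and "x \<noteq> 0"
  shows "norm x - \<beta> * norm (t *\<^sub>R y) \<le> norm (x + t *\<^sub>R y)"
proof -
  define a s m where "a = norm x" and "s = norm (t *\<^sub>R y)" and "m = norm (x + t *\<^sub>R y)"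
  have "a > 0"
    using \<open>x \<noteq> 0\<close> by (simp add: a_def)
  \<comment> \<open>The quadratic bound at \<open>l * t\<close> and convexity of the norm give this; then let \<open>l\<close> tend to 0.\<close>
  have bound: "0 \<le> 2 * a * (m - a + \<beta> * s) + l * (m - a)\<^sup>2" if "0 < l" "l < 1" for l
  proof -
    have "x + (l * t) *\<^sub>R y = (1 - l) *\<^sub>R x + l *\<^sub>R (x + t *\<^sub>R y)"
      by (simp add: algebra_simps)
    then have "norm (x + (l * t) *\<^sub>R y) \<le> (1 - l) * a + l * m"
      using norm_triangle_ineq[of "(1 - l) *\<^sub>R x" "l *\<^sub>R (x + t *\<^sub>R y)"] that
      by (simp add: a_def m_def)
    then have "(norm (x + (l * t) *\<^sub>R y))\<^sup>2 \<le> ((1 - l) * a + l * m)\<^sup>2"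
      by (rule power_mono) simp
    moreover have "a\<^sup>2 - 2 * \<beta> * a * (l * s) \<le> (norm (x + (l * t) *\<^sub>R y))\<^sup>2"
      using assms(1) that unfolding orth_B_def a_def s_def
      by (auto dest!: spec[of _ "l * t"] simp: abs_mult mult.assoc)
    ultimately have "a\<^sup>2 - 2 * \<beta> * a * (l * s) \<le> ((1 - l) * a + l * m)\<^sup>2"
      by linarith
    \<comment> \<open>The terms \<open>a\<^sup>2\<close> cancel, so a factor \<open>l\<close> splits
      off; dividing by it keeps the first-order part when \<open>l\<close> tends to 0.\<close>
    then have "0 \<le> l * (2 * a * (m - a + \<beta> * s) + l * (m - a)\<^sup>2)"
      by (simp add: power2_eq_square algebra_simps)
    then show ?thesis
      using that by (simp add: zero_le_mult_iff)
  qed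
  have "((\<lambda>l. 2 * a * (m - a + \<beta> * s) + l * (m - a)\<^sup>2) \<longlongrightarrow> 2 * a * (m - a + \<beta> * s) + 0 * (m - a)\<^sup>2)
      (at_right 0)"
    by (intro tendsto_intros)
  moreover have "\<forall>\<^sub>F l in at_right 0. 0 \<le> 2 * a * (m - a + \<beta> * s) + l * (m - a)\<^sup>2"
    using bound unfolding eventually_at_right_field by (intro exI[of _ 1]) auto
  ultimately have "0 \<le> 2 * a * (m - a + \<beta> * s) + 0 * (m - a)\<^sup>2"
    by (rule tendsto_lowerbound) simp
  then have "0 \<le> m - a + \<beta> * s"
    using \<open>a > 0\<close> by (simp add: zero_le_mult_iff)
  then show ?thesis
    by (simp add: a_def s_def m_def)
qed

text \<open>The previous bound degrades as \<open>norm (t *\<^sub>R y)\<close> grows, but the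
  triangle inequality bounds that norm by \<open>norm (x + t *\<^sub>R y) + norm x\<close>.
  Substituting this and solving for \<open>norm (x + t *\<^sub>R y)\<close> produces the
  constant.\<close>

lemma orth_B_imp_norm_ge_scaled:
  assumes "orth_B \<beta> x y" and "0 \<le> \<beta>"
  shows "(1 - \<beta>) / (1 + \<beta>) * norm x \<le> norm (x + t *\<^sub>R y)"
proof (cases "x = 0")
  case False
  have "norm (t *\<^sub>R y) \<le> norm (x + t *\<^sub>R y) + norm x"
    using norm_triangle_ineq4[of "x + t *\<^sub>R y" x] by simp
  then have "\<beta> * norm (t *\<^sub>R y) \<le> \<beta> * (norm (x + t *\<^sub>R y) + norm x)"
    using assms(2) by (rule mult_left_mono)
  with orth_B_imp_norm_ge[OF assms(1) False, of t]
  have "(1 - \<beta>) * norm x \<le> norm (x + t *\<^sub>R y) * (1 + \<beta>)"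
    by (simp add: algebra_simps)
  then show ?thesis
    using assms(2) by (simp add: pos_divide_le_eq)
qed simp

text \<open>The vector \<open>x\<close> is the midpoint of \<open>x + t *\<^sub>R y\<close> and
  \<open>x - t *\<^sub>R y\<close>, which have equal norms.\<close>

lemma orth_R_imp_norm_ge:
  assumes "orth_R x y"
  shows "norm x \<le> norm (x + t *\<^sub>R y)"
proof -
  have "2 * norm x = norm ((x + t *\<^sub>R y) + (x - t *\<^sub>R y))"
    by (simp flip: scaleR_2)
  also have "\<dots> \<le> norm (x + t *\<^sub>R y) + norm (x - t *\<^sub>R y)"
    by (rule norm_triangle_ineq)
  finally show ?thesis
    using assms by (simp add: orth_R_def)
qed

text \<open>For nonzero \<open>t\<close>, scaling the hypothesis at \<open>inverse t\<close> by
  \<open>t\<close> swaps the roles of \<open>x\<close> and \<open>y\<close>, up to a sign that the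
  norm ignores.\<close>

lemma orth_R_sym:
  assumes "orth_R x y"
  shows "orth_R y x"
  unfolding orth_R_def
proof
  fix t :: real
  show "norm (y + t *\<^sub>R x) = norm (y - t *\<^sub>R x)"
  proof (cases "t = 0")
    case False
    have "y + t *\<^sub>R x = t *\<^sub>R (x + inverse t *\<^sub>R y)" "t *\<^sub>R x - y = t *\<^sub>R (x - inverse t *\<^sub>R y)"
      using False by (simp_all add: algebra_simps)
    then show ?thesis
      using assms by (simp add: orth_R_def norm_minus_commute[of y])
  qed simp
qed

lemma preserves_D_linear:
  fixes T :: "'a::real_normed_vector \<Rightarrow> 'b::real_normed_vector"
  assumes "linear T"
    and lower: "\<And>z. a * norm z \<le> norm (T z)" and upper: "\<And>z. norm (T z) \<le> b * norm z"
    and "0 < a" "a \<le> b" "0 < k" "k \<le> 1"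
    and ge: "\<And>x y t. \<Delta> x y \<Longrightarrow> k * norm x \<le> norm (x + t *\<^sub>R y)"
  shows "preserves_D \<Delta> (sqrt (1 - (a / b)\<^sup>2 * k\<^sup>2)) T"
proof -
  have q: "0 < a / b" "a / b \<le> 1"
    using assms(4,5) by simp_all
  define r where "r = a / b * k"
  have r: "0 < r" "r \<le> 1"
    unfolding r_def using q assms(6,7) mult_mono[of "a / b" 1 k 1] by (blast intro: mult_pos_pos, simp)
  have "r\<^sup>2 \<le> 1"
    using r by (simp add: power_le_one)
  then have "sqrt (1 - r\<^sup>2) \<in> {0..<1}" and root: "sqrt (1 - (sqrt (1 - r\<^sup>2))\<^sup>2) = r"
    using r by simp_all
  moreover have "orth_D (sqrt (1 - r\<^sup>2)) (T x) (T y)" if "\<Delta> x y" for x y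
    unfolding orth_D_def root
  proof
    fix t :: real
    have "r * norm (T x) \<le> r * (b * norm x)"
      using r by (intro mult_left_mono upper) simp
    \<comment> \<open>Here \<open>r * b = a * k\<close>; \<open>b\<close> is nonzero because
      \<open>0 < a\<close> and \<open>a \<le> b\<close>.\<close>
    also have "\<dots> = a * (k * norm x)"
      using assms(4,5) by (simp add: r_def)
    also have "\<dots> \<le> a * norm (x + t *\<^sub>R y)"
      using \<open>0 < a\<close> that by (intro mult_left_mono ge) simp_all
    also have "\<dots> \<le> norm (T x + t *\<^sub>R T y)"
      using lower[of "x + t *\<^sub>R y"] \<open>linear T\<close> by (simp add: linear_add linear_scale)
    finally show "r * norm (T x) \<le> norm (T x + t *\<^sub>R T y)" .
  qed
  ultimately have "preserves_D \<Delta> (sqrt (1 - r\<^sup>2)) T"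
    unfolding preserves_D_def by blast
  then show ?thesis
    unfolding r_def power_mult_distrib .
qed

theorem theorem2p12:
  fixes T :: "'a::real_normed_vector \<Rightarrow>\<^sub>L 'b::real_normed_vector"
    and \<beta> \<epsilon> :: real
    and \<delta>\<^sub>1 \<delta>\<^sub>2 :: "real \<Rightarrow> real"
  assumes "\<beta> \<in> {0..<1}" and "\<epsilon> \<in> {0..<1}"
    and "T \<noteq> 0"
    and "\<exists>(c::real) U. eps_isometry \<delta>\<^sub>1 \<delta>\<^sub>2 \<epsilon> U \<and> (\<forall>x. blinfun_apply T x = c *\<^sub>R U x)"
    and "\<delta>\<^sub>1 \<epsilon> < 1"
  shows "preserves_D (orth_D \<beta>)
           (sqrt (1 - ((1 - \<delta>\<^sub>1 \<epsilon>) / (1 + \<delta>\<^sub>2 \<epsilon>))\<^sup>2 * (1 - \<beta>\<^sup>2))) (blinfun_apply T)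
     \<and> preserves_D (orth_B \<beta>)
           (sqrt (1 - ((1 - \<delta>\<^sub>1 \<epsilon>) / (1 + \<delta>\<^sub>2 \<epsilon>))\<^sup>2 * ((1 - \<beta>) / (1 + \<beta>))\<^sup>2)) (blinfun_apply T)
     \<and> preserves_D orth_R
           (sqrt (1 - ((1 - \<delta>\<^sub>1 \<epsilon>) / (1 + \<delta>\<^sub>2 \<epsilon>))\<^sup>2)) (blinfun_apply T)
     \<and> reverses_D orth_R
           (sqrt (1 - ((1 - \<delta>\<^sub>1 \<epsilon>) / (1 + \<delta>\<^sub>2 \<epsilon>))\<^sup>2)) (blinfun_apply T)"
proof -
  obtain c U where U: "eps_isometry \<delta>\<^sub>1 \<delta>\<^sub>2 \<epsilon> U" and T: "\<And>x. blinfun_apply T x = c *\<^sub>R U x"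
    using assms(4) by blast
  obtain x\<^sub>0 where x\<^sub>0: "blinfun_apply T x\<^sub>0 \<noteq> 0"
    using \<open>T \<noteq> 0\<close> by (metis blinfun_eqI zero_blinfun.rep_eq)
  \<comment> \<open>The scalar is absorbed into both bounds and cancels in \<open>a / b\<close>, so
    the constants for \<open>T\<close> are those for \<open>U\<close>.\<close>
  define a b where "a = \<bar>c\<bar> * (1 - \<delta>\<^sub>1 \<epsilon>)" and "b = \<bar>c\<bar> * (1 + \<delta>\<^sub>2 \<epsilon>)"
  have "c \<noteq> 0"
    using x\<^sub>0 T by auto
  then have "0 < a" and q: "a / b = (1 - \<delta>\<^sub>1 \<epsilon>) / (1 + \<delta>\<^sub>2 \<epsilon>)"
    using assms(5) by (simp_all add: a_def b_def)
  have lower: "a * norm z \<le> norm (blinfun_apply T z)"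
    and upper: "norm (blinfun_apply T z) \<le> b * norm z" for z
    using U by (simp_all add: T a_def b_def eps_isometry_def mult.assoc mult_left_mono)
  \<comment> \<open>The values of \<open>\<delta>\<^sub>1\<close> and
    \<open>\<delta>\<^sub>2\<close> may be negative, so \<open>a \<le> b\<close> is read off from
    the two bounds at a nonzero vector. It also forces
    \<open>1 + \<delta>\<^sub>2 \<epsilon>\<close> to be positive.\<close>
  have "x\<^sub>0 \<noteq> 0"
    using x\<^sub>0 by auto
  then have "a \<le> b"
    using order_trans[OF lower upper, of x\<^sub>0] by simp
  note preserves = preserves_D_linear
    [OF blinfun.bounded_linear_right[THEN bounded_linear.linear] lower upper \<open>0 < a\<close> \<open>a \<le> b\<close>,
      unfolded q]
  have \<beta>: "0 \<le> \<beta>" "\<beta> < 1" "\<beta>\<^sup>2 < 1"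
    using assms(1) by (simp_all add: power_less_one_iff abs_square_less_1)
  have "preserves_D (orth_D \<beta>)
      (sqrt (1 - ((1 - \<delta>\<^sub>1 \<epsilon>) / (1 + \<delta>\<^sub>2 \<epsilon>))\<^sup>2 * (sqrt (1 - \<beta>\<^sup>2))\<^sup>2)) (blinfun_apply T)"
    using \<beta> by (intro preserves) (simp_all add: orth_D_def)
  moreover have "preserves_D (orth_B \<beta>)
      (sqrt (1 - ((1 - \<delta>\<^sub>1 \<epsilon>) / (1 + \<delta>\<^sub>2 \<epsilon>))\<^sup>2 * ((1 - \<beta>) / (1 + \<beta>))\<^sup>2)) (blinfun_apply T)"
    using \<beta> by (intro preserves orth_B_imp_norm_ge_scaled) simp_all
  moreover have R: "preserves_D orth_R
      (sqrt (1 - ((1 - \<delta>\<^sub>1 \<epsilon>) / (1 + \<delta>\<^sub>2 \<epsilon>))\<^sup>2)) (blinfun_apply T)"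
    using preserves[of 1 orth_R] by (simp add: orth_R_imp_norm_ge)
  \<comment> \<open>Symmetry of \<open>orth_R\<close> turns preservation into reversal with the same
    constant.\<close>
  moreover have "reverses_D orth_R
      (sqrt (1 - ((1 - \<delta>\<^sub>1 \<epsilon>) / (1 + \<delta>\<^sub>2 \<epsilon>))\<^sup>2)) (blinfun_apply T)"
    using R orth_R_sym unfolding preserves_D_def reverses_D_def by blast
  ultimately show ?thesis
    using \<beta> by simp
qed

end
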